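(* Let $(V,E,S,c)$ be an Eulerian network and let $\mu$ be a directed metric on $S$. Then $$\max\{\operatorname{val}(\mu,f) : f \text{ a multiflow in } (V,E,S,c)\}=\min\Big\{\sum_{xy\in E}c(xy)\,D_\infty(\rho(x),\rho(y)) : \rho:V\to Q_\mu,\ \overline{\rho(s)}=\bar\mu_s\ (s\in S)\Big\}.$$
   Context: A network $(V,E,S,c)$ consists of a (finite) directed graph $(V,E)$, a specified vertex subset $S\subseteq V$ (terminals), and a nonnegative integer-valued edge-capacity $c:E\to\mathbf{Z}_+$. An edge with tail $x$ and head $y$ is denoted $xy$. The network is Eulerian if for each vertex $x\in V$ the sum of capacities over all edges entering $x$ equals the sum of capacities over all edges leaving $x$. An $S$-path is a directed path in $(V,E)$ connecting distinct terminals in $S$. A multiflow is a pair $f=(\mathcal{P},\lambda)$ of a set $\mathcal{P}$ of $S$-paths and a function $\lambda:\mathcal{P}\to\mathbf{R}_+$ such that $\sum\{\lambda(P) : P\in\mathcal{P},\ P\text{ contains }e\}\le c(e)$ for all $e\in E$. Its value is $\operatorname{val}(\mu,f)=\sum_{P\in\mathcal{P}}\mu(s_P,t_P)\lambda(P)$, where $s_P$, $t_P$ are the starting and end vertices of $P$. A directed metric on $S$ is a function $\mu:S\times S\to\mathbf{R}_+$ with $\mu(x,x)=0$ and $\mu(x,y)+\mu(y,z)\ge\mu(x,z)$ for all $x,y,z$ (not necessarily symmetric). Let $S^c,S^r$ be two disjoint copies of $S$, with $s^c\in S^c$, $s^r\in S^r$ the copies of $s\in S$, and $S^{cr}=S^c\cup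 S^r$. For $p\in\mathbf{R}^{S^{cr}}$, $p^c$ and $p^r$ are its restrictions to $S^c$ and $S^r$. Let $\Pi_\mu=\{p\in\mathbf{R}^{S^{cr}} : p(s^c)+p(t^r)\ge\mu(s,t)\ \forall s,t\in S\}$, and let $Q_\mu$ be the set of minimal elements of $\Pi_\mu$ (points $p\in\Pi_\mu$ for which no $q\in\Pi_\mu$, $q\ne p$, satisfies $q\le p$ coordinatewise). Let $(\mathbf{1},-\mathbf{1})\in\mathbf{R}^{S^{cr}}$ be $1$ on $S^c$ and $-1$ on $S^r$; $\bar p$ (or $\overline{p}$) denotes the image of $p$ in $\mathbf{R}^{S^{cr}}/(\mathbf{1},-\mathbf{1})\mathbf{R}$. For $p,q\in\mathbf{R}^X$ ($X$ finite), $D_\infty^+(p,q)=\max_{x\in X}\max\{q(x)-p(x),0\}$; for $p,q\in\mathbf{R}^{S^{cr}}$, $D_\infty(p,q)=\max\{D_\infty^+(p^c,q^c),D_\infty^+(q^r,p^r)\}$. For $s\in S$, $\mu_s\in\mathbf{R}^{S^{cr}}$ is given by $\mu_s(t^c)=\mu(t,s)$, $\mu_s(t^r)=\mu(s,t)$ $(t\in S)$. *)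

theory Defs
  imports "HOL-Analysis.Analysis" "Graph_Theory.Arc_Walk"
begin

section \<open>Eulerian networks and multiflows\<close>

text \<open>
  A network is a finite directed graph in the sense of \<^locale>\<open>fin_digraph\<close> (so parallel arcs and
  loops are permitted), with terminals \<open>S\<close> and integer capacities \<open>c\<close>.
\<close>

locale network = fin_digraph G
  for G :: "('a, 'b) pre_digraph" +
  fixes S :: "'a set" and c :: "'b \<Rightarrow> nat"
  assumes terminals: "S \<subseteq> verts G"

locale eulerian_network = network +
  assumes eulerian: "x \<in> verts G \<Longrightarrow> (\<Sum>e\<in>in_arcs G x. c e) = (\<Sum>e\<in>out_arcs G x. c e)"

text \<open>
  Paths are given by their lists of arcs and do not repeat vertices; their inner vertices may be
  terminals. An \<open>S\<close>-path is a non-empty list since its ends are distinct.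
\<close>

definition S_paths :: "('a, 'b) pre_digraph \<Rightarrow> 'a set \<Rightarrow> 'b list set" where
  "S_paths G S = {p. \<exists>s\<in>S. \<exists>t\<in>S. s \<noteq> t \<and> pre_digraph.apath G s p t}"

definition path_start :: "('a, 'b) pre_digraph \<Rightarrow> 'b list \<Rightarrow> 'a" where
  "path_start G p = tail G (hd p)"

definition path_end :: "('a, 'b) pre_digraph \<Rightarrow> 'b list \<Rightarrow> 'a" where
  "path_end G p = head G (last p)"

text \<open>The values of the weight function outside of the set of paths are irrelevant.\<close>

definition multiflow ::
  "('a, 'b) pre_digraph \<Rightarrow> 'a set \<Rightarrow> ('b \<Rightarrow> nat) \<Rightarrow> 'b list set \<times> ('b list \<Rightarrow> real) \<Rightarrow> bool" where
  "multiflow G S c = (\<lambda>(P, w).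
     P \<subseteq> S_paths G S \<and> (\<forall>p\<in>P. 0 \<le> w p) \<and>
     (\<forall>e\<in>arcs G. (\<Sum>p\<in>{p \<in> P. e \<in> set p}. w p) \<le> real (c e)))"

definition flow_val ::
  "('a, 'b) pre_digraph \<Rightarrow> ('a \<Rightarrow> 'a \<Rightarrow> real) \<Rightarrow> 'b list set \<times> ('b list \<Rightarrow> real) \<Rightarrow> real" where
  "flow_val G \<mu> = (\<lambda>(P, w). \<Sum>p\<in>P. \<mu> (path_start G p) (path_end G p) * w p)"


section \<open>Directed metrics and their tight spans\<close>

definition directed_metric_on :: "'a set \<Rightarrow> ('a \<Rightarrow> 'a \<Rightarrow> real) \<Rightarrow> bool" where
  "directed_metric_on S \<mu> \<longleftrightarrow>
     (\<forall>x\<in>S. \<forall>y\<in>S. 0 \<le> \<mu> x y) \<and> (\<forall>x\<in>S. \<mu> x x = 0) \<and>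
     (\<forall>x\<in>S. \<forall>y\<in>S. \<forall>z\<in>S. \<mu> x z \<le> \<mu> x y + \<mu> y z)"

text \<open>
  \<open>S\<^sup>c\<^sup>r\<close> is the disjoint sum \<open>S <+> S\<close>, with \<open>s\<^sup>c = Inl s\<close> and \<open>s\<^sup>r = Inr s\<close>. A vector in
  \<open>\<real>\<^sup>X\<close> is a function that is \<open>undefined\<close> outside of \<open>X\<close>, so that equality of vectors is equality
  of functions.
\<close>

abbreviation Rvec :: "'i set \<Rightarrow> ('i \<Rightarrow> real) set" where
  "Rvec X \<equiv> X \<rightarrow>\<^sub>E (UNIV :: real set)"

definition Pi_mu :: "'a set \<Rightarrow> ('a \<Rightarrow> 'a \<Rightarrow> real) \<Rightarrow> ('a + 'a \<Rightarrow> real) set" where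
  "Pi_mu S \<mu> = {p \<in> Rvec (S <+> S). \<forall>s\<in>S. \<forall>t\<in>S. \<mu> s t \<le> p (Inl s) + p (Inr t)}"

definition Q_mu :: "'a set \<Rightarrow> ('a \<Rightarrow> 'a \<Rightarrow> real) \<Rightarrow> ('a + 'a \<Rightarrow> real) set" where
  "Q_mu S \<mu> = {p \<in> Pi_mu S \<mu>. \<not> (\<exists>q\<in>Pi_mu S \<mu>. q \<noteq> p \<and> (\<forall>x\<in>S <+> S. q x \<le> p x))}"

definition one_minus_one :: "'a + 'a \<Rightarrow> real" where
  "one_minus_one = case_sum (\<lambda>_. 1) (\<lambda>_. -1)"

text \<open>The image of \<open>p\<close> in \<open>\<real>\<^sup>X/(1,-1)\<real>\<close> for \<open>X = S\<^sup>c\<^sup>r\<close>, as a coset.\<close>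

definition bar :: "'a set \<Rightarrow> ('a + 'a \<Rightarrow> real) \<Rightarrow> ('a + 'a \<Rightarrow> real) set" where
  "bar S p = {q \<in> Rvec (S <+> S). \<exists>k::real. \<forall>x\<in>S <+> S. q x = p x + k * one_minus_one x}"

text \<open>
  Inserting \<open>0\<close> matters only for \<open>X = {}\<close>, where the distance is \<open>0\<close>: all other members of the
  set are nonnegative.
\<close>

definition D_plus :: "'i set \<Rightarrow> ('i \<Rightarrow> real) \<Rightarrow> ('i \<Rightarrow> real) \<Rightarrow> real" where
  "D_plus X p q = Max (insert 0 ((\<lambda>x. max (q x - p x) 0) ` X))"

definition D_infty :: "'a set \<Rightarrow> ('a + 'a \<Rightarrow> real) \<Rightarrow> ('a + 'a \<Rightarrow> real) \<Rightarrow> real" where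
  "D_infty S p q = max (D_plus (Inl ` S) p q) (D_plus (Inr ` S) q p)"

definition mu_vec :: "'a set \<Rightarrow> ('a \<Rightarrow> 'a \<Rightarrow> real) \<Rightarrow> 'a \<Rightarrow> ('a + 'a \<Rightarrow> real)" where
  "mu_vec S \<mu> s = restrict (case_sum (\<lambda>t. \<mu> t s) (\<lambda>t. \<mu> s t)) (S <+> S)"

definition potentials ::
  "('a, 'b) pre_digraph \<Rightarrow> 'a set \<Rightarrow> ('a \<Rightarrow> 'a \<Rightarrow> real) \<Rightarrow> ('a \<Rightarrow> 'a + 'a \<Rightarrow> real) set" where
  "potentials G S \<mu> =
     {\<rho>. \<rho> \<in> verts G \<rightarrow> Q_mu S \<mu> \<and> (\<forall>s\<in>S. bar S (\<rho> s) = bar S (mu_vec S \<mu> s))}"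

definition potential_cost ::
  "('a, 'b) pre_digraph \<Rightarrow> 'a set \<Rightarrow> ('b \<Rightarrow> nat) \<Rightarrow> ('a \<Rightarrow> 'a + 'a \<Rightarrow> real) \<Rightarrow> real" where
  "potential_cost G S c \<rho> =
     (\<Sum>e\<in>arcs G. real (c e) * D_infty S (\<rho> (tail G e)) (\<rho> (head G e)))"


section \<open>Maximum and minimum of possibly infinite sets\<close>

text \<open>\<^const>\<open>Max\<close> and \<^const>\<open>Min\<close> are unspecified on infinite sets.\<close>

definition is_max :: "real set \<Rightarrow> real \<Rightarrow> bool" where
  "is_max A m \<longleftrightarrow> m \<in> A \<and> (\<forall>a\<in>A. a \<le> m)"

definition is_min :: "real set \<Rightarrow> real \<Rightarrow> bool" where
  "is_min A m \<longleftrightarrow> m \<in> A \<and> (\<forall>a\<in>A. m \<le> a)"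

end

theory Submission
  imports Defs
begin

text \<open>
  Linear programming duality turns the maximum multiflow value into the minimum of
  \<open>\<Sum>e. c e * l e\<close> over arc lengths \<open>l \<ge> 0\<close> for which every \<open>S\<close>-path from \<open>s\<close> to \<open>t\<close> has length at
  least \<open>\<mu> s t\<close> (\<open>multiflow_duality\<close>). What remains is to compare such lengths with potentials.

  From lengths to potentials: let \<open>a s x\<close> be the distance from the terminal \<open>s\<close> to the vertex \<open>x\<close>,
  capped by a large constant. Lower the vector \<open>a _ x\<close> on \<open>S\<^sup>c\<close> to a minimal point of \<open>\<Pi>\<^sub>\<mu>\<close> by
  conjugating twice, \<open>b t = max\<^sub>s (\<mu> s t - a s x)\<close> on \<open>S\<^sup>r\<close> and then \<open>max\<^sub>t (\<mu> s t - b t)\<close> on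
  \<open>S\<^sup>c\<close>. Conjugation reverses order and does not increase one-sided distances, which is the sign
  pattern of \<open>D\<^sub>\<infinity>\<close>: the distance across an arc is at most the length of the arc. At a terminal
  \<open>u\<close> the result is exactly \<open>\<mu>\<^sub>u\<close>, by the triangle inequality. So the potential costs at most
  \<open>\<Sum>e. c e * l e\<close> (\<open>potential_below_lengths\<close>).

  From potentials to flows: a potential is \<open>\<mu>\<^sub>s + k\<^sub>s (1,-1)\<close> at the terminal \<open>s\<close>, with an unknown
  shift \<open>k\<^sub>s\<close>, so that the \<open>D\<^sub>\<infinity>\<close>-length of an \<open>S\<close>-path from \<open>s\<close> to \<open>t\<close> is only known to be at least
  \<open>\<mu> s t + k\<^sub>t - k\<^sub>s\<close>. The function \<open>min_c\<close>, the least coordinate on \<open>S\<^sup>c\<close>, recovers \<open>k\<^sub>s\<close> from the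
  point and grows by at most \<open>D\<^sub>\<infinity>\<close> along an arc. Subtracting its increase from the \<open>D\<^sub>\<infinity>\<close>-length of
  every arc thus leaves nonnegative lengths that give each \<open>S\<close>-path at least \<open>\<mu> s t\<close>; and in an
  Eulerian network the increases of any function, weighted by capacities, sum to \<open>0\<close>, so the total
  cost is unchanged (\<open>flow_val_le_potential_cost\<close>).
\<close>

section \<open>Linear programming duality for fractional packings\<close>

text \<open>
  Farkas' lemma, by induction on the number of inequalities. If the last one, \<open>A k x \<le> 0\<close>, is
  needed for the implication, then there is a point \<open>x1\<close> with \<open>b x1 > 0\<close> that satisfies the others
  and violates it, with \<open>A k x1 = 1\<close> after scaling. Projecting along \<open>x1\<close> onto the kernel of \<open>A k\<close> removes this
  inequality, and the multipliers for the projected system determine the missing one, whose sign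
  is right because \<open>b x1 > 0\<close> and \<open>A i x1 \<le> 0\<close> for the other \<open>i\<close>.
\<close>

lemma farkas:
  fixes A :: "'i \<Rightarrow> 'j \<Rightarrow> real" and b :: "'j \<Rightarrow> real"
  assumes "finite I" "finite J"
    and "\<And>x. (\<forall>i\<in>I. (\<Sum>j\<in>J. A i j * x j) \<le> 0) \<Longrightarrow> (\<Sum>j\<in>J. b j * x j) \<le> 0"
  shows "\<exists>y. (\<forall>i\<in>I. 0 \<le> y i) \<and> (\<forall>j\<in>J. b j = (\<Sum>i\<in>I. y i * A i j))"
  using assms(1,3)
proof (induction I arbitrary: A b rule: finite_induct)
  case empty
  have "(\<Sum>j\<in>J. b j * b j) \<le> 0" using empty[of b] by simp
  moreover have "(\<Sum>j\<in>J. b j * b j) \<ge> 0" by (simp add: sum_nonneg)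
  ultimately have "(\<Sum>j\<in>J. b j * b j) = 0" by simp
  then have "\<forall>j\<in>J. b j = 0"
    using sum_nonneg_eq_0_iff[OF assms(2), of "\<lambda>j. b j * b j"] by simp
  then show ?case by simp
next
  case (insert k I)
  show ?case
  proof (cases "\<forall>x. (\<forall>i\<in>I. (\<Sum>j\<in>J. A i j * x j) \<le> 0) \<longrightarrow> (\<Sum>j\<in>J. b j * x j) \<le> 0")
    case True
    then obtain y where y: "\<forall>i\<in>I. 0 \<le> y i" "\<forall>j\<in>J. b j = (\<Sum>i\<in>I. y i * A i j)"
      using insert.IH[of A b] by blast
    have "(\<Sum>i\<in>insert k I. (y(k := 0)) i * A i j) = (\<Sum>i\<in>I. y i * A i j)" for j
      using insert.hyps by (auto intro!: sum.cong)
    then show ?thesis using y by (intro exI[of _ "y(k := 0)"]) auto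
  next
    case False
    then obtain x0 where x0: "\<forall>i\<in>I. (\<Sum>j\<in>J. A i j * x0 j) \<le> 0" "(\<Sum>j\<in>J. b j * x0 j) > 0"
      by (auto simp: not_le)
    define z where "z = (\<Sum>j\<in>J. A k j * x0 j)"
    have "z > 0" using insert.prems[of x0] x0 unfolding z_def by fastforce
    define x1 where "x1 j = x0 j / z" for j
    define val where "val a = (\<Sum>j\<in>J. a j * x1 j)" for a :: "'j \<Rightarrow> real"
    have val_x0: "val a = (\<Sum>j\<in>J. a j * x0 j) / z" for a
      unfolding val_def x1_def by (simp add: sum_divide_distrib)
    have val_k: "val (A k) = 1" using \<open>z > 0\<close> by (simp add: val_x0 z_def)
    have val_I: "val (A i) \<le> 0" if "i \<in> I" for i
      using x0(1) that \<open>z > 0\<close> by (simp add: val_x0 divide_nonpos_pos)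
    have val_b: "val b > 0" using x0(2) \<open>z > 0\<close> by (simp add: val_x0)
    \<comment> \<open>the functional \<open>a\<close> composed with the projection along \<open>x1\<close> onto the kernel of \<open>A k\<close>\<close>
    define pr where "pr a j = a j - A k j * val a" for a j
    have pr_apply: "(\<Sum>j\<in>J. pr a j * x j) =
        (\<Sum>j\<in>J. a j * (x j - (\<Sum>j\<in>J. A k j * x j) * x1 j))" for a x
    proof -
      define r where "r = (\<Sum>j\<in>J. A k j * x j)"
      have "pr a j * x j = a j * x j - val a * (A k j * x j)" for j
        unfolding pr_def by (simp add: algebra_simps)
      then have "(\<Sum>j\<in>J. pr a j * x j) = (\<Sum>j\<in>J. a j * x j) - r * val a"
        by (simp add: sum_subtractf sum_distrib_left[symmetric] r_def)
      also have "\<dots> = (\<Sum>j\<in>J. a j * (x j - r * x1 j))"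
        unfolding val_def
        by (simp add: right_diff_distrib sum_subtractf sum_distrib_left mult_ac)
      finally show ?thesis unfolding r_def .
    qed
    have "\<exists>y. (\<forall>i\<in>I. 0 \<le> y i) \<and> (\<forall>j\<in>J. pr b j = (\<Sum>i\<in>I. y i * pr (A i) j))"
    proof (rule insert.IH)
      fix x assume le: "\<forall>i\<in>I. (\<Sum>j\<in>J. pr (A i) j * x j) \<le> 0"
      define r where "r = (\<Sum>j\<in>J. A k j * x j)"
      define x' where "x' j = x j - r * x1 j" for j
      have "A k j * x' j = A k j * x j - r * (A k j * x1 j)" for j
        unfolding x'_def by (simp add: algebra_simps)
      then have "(\<Sum>j\<in>J. A k j * x' j) = r - r * val (A k)"
        by (simp add: sum_subtractf sum_distrib_left[symmetric] r_def val_def)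
      then have "(\<Sum>j\<in>J. A k j * x' j) = 0" by (simp add: val_k)
      moreover have "\<forall>i\<in>I. (\<Sum>j\<in>J. A i j * x' j) \<le> 0"
        using le unfolding pr_apply x'_def r_def .
      ultimately have "(\<Sum>j\<in>J. b j * x' j) \<le> 0"
        by (intro insert.prems) simp
      then show "(\<Sum>j\<in>J. pr b j * x j) \<le> 0" unfolding pr_apply x'_def r_def .
    qed
    then obtain y where y: "\<forall>i\<in>I. 0 \<le> y i" "\<And>j. j \<in> J \<Longrightarrow> pr b j = (\<Sum>i\<in>I. y i * pr (A i) j)"
      by blast
    define y' where "y' = y(k := val b - (\<Sum>i\<in>I. y i * val (A i)))"
    have "(\<Sum>i\<in>I. y i * val (A i)) \<le> 0"
      using y(1) val_I by (intro sum_nonpos) (simp add: mult_nonneg_nonpos)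
    then have "\<forall>i\<in>insert k I. 0 \<le> y' i" using y(1) val_b unfolding y'_def by auto
    moreover have "b j = (\<Sum>i\<in>insert k I. y' i * A i j)" if "j \<in> J" for j
    proof -
      have "(\<Sum>i\<in>I. y' i * A i j) = (\<Sum>i\<in>I. y i * A i j)"
        using insert.hyps by (intro sum.cong) (auto simp: y'_def)
      then have "(\<Sum>i\<in>insert k I. y' i * A i j) =
          (val b - (\<Sum>i\<in>I. y i * val (A i))) * A k j + (\<Sum>i\<in>I. y i * A i j)"
        using insert.hyps by (simp add: y'_def)
      moreover have "pr b j = (\<Sum>i\<in>I. y i * A i j) - (\<Sum>i\<in>I. y i * val (A i)) * A k j"
        using y(2)[OF that] unfolding pr_def
        by (simp add: algebra_simps sum_subtractf sum_distrib_left)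
      ultimately show ?thesis unfolding pr_def by (simp add: algebra_simps)
    qed
    ultimately show ?thesis by blast
  qed
qed

lemma farkas_nonneg:
  fixes A :: "'i \<Rightarrow> 'j \<Rightarrow> real" and b :: "'j \<Rightarrow> real"
  assumes "finite I" "finite J"
    and imp: "\<And>x. (\<forall>j\<in>J. 0 \<le> x j) \<Longrightarrow> (\<forall>i\<in>I. (\<Sum>j\<in>J. A i j * x j) \<le> 0) \<Longrightarrow>
           (\<Sum>j\<in>J. b j * x j) \<le> 0"
  shows "\<exists>y. (\<forall>i\<in>I. 0 \<le> y i) \<and> (\<forall>j\<in>J. b j \<le> (\<Sum>i\<in>I. y i * A i j))"
proof -
  \<comment> \<open>the sign constraints become the extra rows \<open>- x k \<le> 0\<close>\<close>
  define A' where "A' = case_sum A (\<lambda>k j. if j = k then - 1 else 0)"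
  have "\<exists>y. (\<forall>i\<in>I <+> J. 0 \<le> y i) \<and> (\<forall>j\<in>J. b j = (\<Sum>i\<in>I <+> J. y i * A' i j))"
  proof (rule farkas)
    fix x assume *: "\<forall>i\<in>I <+> J. (\<Sum>j\<in>J. A' i j * x j) \<le> 0"
    have "(\<Sum>j\<in>J. A' (Inr k) j * x j) = - x k" if "k \<in> J" for k
    proof -
      have "(\<Sum>j\<in>J. A' (Inr k) j * x j) = (\<Sum>j\<in>J. if j = k then - x j else 0)"
        unfolding A'_def by (intro sum.cong) auto
      then show ?thesis using that assms(2) by simp
    qed
    then have "\<forall>j\<in>J. 0 \<le> x j" using * by (metis InrI neg_le_0_iff_le)
    moreover have "\<forall>i\<in>I. (\<Sum>j\<in>J. A i j * x j) \<le> 0" using * by (force simp: A'_def)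
    ultimately show "(\<Sum>j\<in>J. b j * x j) \<le> 0" by (rule imp)
  qed (use assms in auto)
  then obtain y where y: "\<forall>i\<in>I <+> J. 0 \<le> y i" "\<forall>j\<in>J. b j = (\<Sum>i\<in>I <+> J. y i * A' i j)"
    by blast
  have "b j \<le> (\<Sum>i\<in>I. y (Inl i) * A i j)" if "j \<in> J" for j
  proof -
    have "(\<Sum>k\<in>J. y (Inr k) * A' (Inr k) j) \<le> 0"
      using y(1) by (intro sum_nonpos) (auto simp: A'_def)
    then show ?thesis
      using y(2) that assms(1,2) by (simp add: sum.Plus A'_def)
  qed
  then show ?thesis using y(1) by (intro exI[of _ "\<lambda>i. y (Inl i)"]) auto
qed

text \<open>
  Since every \<open>B p\<close> contains some \<open>e\<close>, each weight is at most a capacity. The feasible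
  weightings, set to \<open>0\<close> outside of \<open>P\<close>, are therefore a closed subset of a product of compact
  intervals.
\<close>

lemma packing_attains_max:
  fixes B :: "'p \<Rightarrow> 'e set" and c :: "'e \<Rightarrow> real" and m :: "'p \<Rightarrow> real"
  assumes "finite P" "finite E"
    and B: "\<And>p. p \<in> P \<Longrightarrow> B p \<subseteq> E" "\<And>p. p \<in> P \<Longrightarrow> B p \<noteq> {}"
    and c: "\<And>e. e \<in> E \<Longrightarrow> 0 \<le> c e"
  obtains w where "\<forall>p\<in>P. 0 \<le> w p" "\<forall>e\<in>E. (\<Sum>p | p \<in> P \<and> e \<in> B p. w p) \<le> c e"
    "\<forall>v. (\<forall>p\<in>P. 0 \<le> v p) \<and> (\<forall>e\<in>E. (\<Sum>p | p \<in> P \<and> e \<in> B p. v p) \<le> c e) \<longrightarrow>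
       (\<Sum>p\<in>P. m p * v p) \<le> (\<Sum>p\<in>P. m p * w p)"
proof -
  define K0 where "K0 = PiE UNIV (\<lambda>p. if p \<in> P then {0..sum c E} else {0::real})"
  define K where "K = K0 \<inter> (\<Inter>e\<in>E. {w. (\<Sum>p | p \<in> P \<and> e \<in> B p. w p) \<le> c e})"
  have "compactin (product_topology (\<lambda>_. euclidean) UNIV) K0"
    unfolding K0_def by (subst compactin_PiE) auto
  then have "compact K0" by (simp add: euclidean_product_topology)
  moreover have "closed (\<Inter>e\<in>E. {w. (\<Sum>p | p \<in> P \<and> e \<in> B p. w p) \<le> c e})"
    by (intro closed_INT ballI closed_Collect_le continuous_intros)
       (auto intro: continuous_on_subset[OF continuous_on_product_coordinates])
  ultimately have "compact K" unfolding K_def by (rule compact_Int_closed)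
  moreover have "K \<noteq> {}"
  proof -
    have "(\<lambda>_. 0) \<in> K" using c by (auto simp: K_def K0_def sum_nonneg)
    then show ?thesis by blast
  qed
  moreover have "continuous_on K (\<lambda>w. \<Sum>p\<in>P. m p * w p)"
    by (intro continuous_intros continuous_on_subset[OF continuous_on_product_coordinates]) auto
  ultimately obtain w where w: "w \<in> K"
    "\<forall>v\<in>K. (\<Sum>p\<in>P. m p * v p) \<le> (\<Sum>p\<in>P. m p * w p)"
    using continuous_attains_sup by blast
  show ?thesis
  proof
    have "w p \<in> (if p \<in> P then {0..sum c E} else {0::real})" for p
      using w(1) by (auto simp: K_def K0_def PiE_def Pi_def)
    then show "\<forall>p\<in>P. 0 \<le> w p" by (metis atLeastAtMost_iff)
    show "\<forall>e\<in>E. (\<Sum>p | p \<in> P \<and> e \<in> B p. w p) \<le> c e" using w(1) by (auto simp: K_def)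
    show "\<forall>v. (\<forall>p\<in>P. 0 \<le> v p) \<and> (\<forall>e\<in>E. (\<Sum>p | p \<in> P \<and> e \<in> B p. v p) \<le> c e) \<longrightarrow>
       (\<Sum>p\<in>P. m p * v p) \<le> (\<Sum>p\<in>P. m p * w p)"
    proof (intro allI impI, elim conjE)
      fix v assume v: "\<forall>p\<in>P. 0 \<le> v p" "\<forall>e\<in>E. (\<Sum>p | p \<in> P \<and> e \<in> B p. v p) \<le> c e"
      define v' where "v' p = (if p \<in> P then v p else 0)" for p
      have "v p \<le> sum c E" if p: "p \<in> P" for p
      proof -
        obtain e where e: "e \<in> B p" using B(2)[OF p] by blast
        then have eE: "e \<in> E" using B(1)[OF p] by blast
        have "v p \<le> (\<Sum>p | p \<in> P \<and> e \<in> B p. v p)"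
          using v(1) e p assms(1) by (intro member_le_sum) auto
        also have "\<dots> \<le> c e" using v(2) eE by blast
        also have "\<dots> \<le> sum c E" using eE c assms(2) by (intro member_le_sum) auto
        finally show ?thesis .
      qed
      moreover have "(\<Sum>p | p \<in> P \<and> e \<in> B p. v' p) = (\<Sum>p | p \<in> P \<and> e \<in> B p. v p)" for e
        by (intro sum.cong) (auto simp: v'_def)
      ultimately have "v' \<in> K" using v by (auto simp: K_def K0_def v'_def)
      then have "(\<Sum>p\<in>P. m p * v' p) \<le> (\<Sum>p\<in>P. m p * w p)" using w(2) by blast
      then show "(\<Sum>p\<in>P. m p * v p) \<le> (\<Sum>p\<in>P. m p * w p)" by (simp add: v'_def)
    qed
  qed
qed

text \<open>
  Farkas' lemma is applied to the homogenized packing problem, in which a further variable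
  (\<open>None\<close>) scales the capacities: if \<open>M\<close> is the maximum, then \<open>\<Sum>p. m p * x p \<le> M * x None\<close>
  follows from \<open>\<Sum>{x p | e \<in> B p} \<le> c e * x None\<close>. The multipliers of these inequalities are the
  dual solution.
\<close>

lemma packing_covering_duality:
  fixes B :: "'p \<Rightarrow> 'e set" and c :: "'e \<Rightarrow> real" and m :: "'p \<Rightarrow> real"
  assumes "finite P" "finite E"
    and B: "\<And>p. p \<in> P \<Longrightarrow> B p \<subseteq> E" "\<And>p. p \<in> P \<Longrightarrow> B p \<noteq> {}"
    and c: "\<And>e. e \<in> E \<Longrightarrow> 0 \<le> c e"
  obtains w l where "\<forall>p\<in>P. 0 \<le> w p" "\<forall>e\<in>E. (\<Sum>p | p \<in> P \<and> e \<in> B p. w p) \<le> c e"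
    "\<forall>e\<in>E. 0 \<le> l e" "\<forall>p\<in>P. m p \<le> (\<Sum>e\<in>B p. l e)"
    "(\<Sum>e\<in>E. c e * l e) \<le> (\<Sum>p\<in>P. m p * w p)"
proof -
  obtain w where w: "\<forall>p\<in>P. 0 \<le> w p" "\<forall>e\<in>E. (\<Sum>p | p \<in> P \<and> e \<in> B p. w p) \<le> c e"
    and max: "\<forall>v. (\<forall>p\<in>P. 0 \<le> v p) \<and> (\<forall>e\<in>E. (\<Sum>p | p \<in> P \<and> e \<in> B p. v p) \<le> c e) \<longrightarrow>
       (\<Sum>p\<in>P. m p * v p) \<le> (\<Sum>p\<in>P. m p * w p)"
    by (rule packing_attains_max[OF assms, where m = m])
  define M where "M = (\<Sum>p\<in>P. m p * w p)"
  define A where "A e = case_option (- c e) (\<lambda>p. if e \<in> B p then 1 else 0)" for e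
  define b where "b = case_option (- M) m"
  define J where "J = insert None (Some ` P)"
  have sum_J: "sum f J = f None + (\<Sum>p\<in>P. f (Some p))" for f :: "'p option \<Rightarrow> real"
    using assms(1) by (simp add: J_def sum.reindex)
  have "\<exists>l. (\<forall>e\<in>E. 0 \<le> l e) \<and> (\<forall>j\<in>J. b j \<le> (\<Sum>e\<in>E. l e * A e j))"
  proof (rule farkas_nonneg)
    fix x assume x0: "\<forall>j\<in>J. 0 \<le> x j" and "\<forall>e\<in>E. (\<Sum>j\<in>J. A e j * x j) \<le> 0"
    then have "\<forall>e\<in>E. (\<Sum>p\<in>P. if e \<in> B p then x (Some p) else 0) \<le> c e * x None"
      by (simp add: sum_J A_def if_distrib[of "\<lambda>a. a * _"] cong: if_cong)
    then have x: "\<forall>e\<in>E. (\<Sum>p | p \<in> P \<and> e \<in> B p. x (Some p)) \<le> c e * x None"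
      using assms(1) by (simp add: sum.inter_filter)
    have x_nonneg: "x None \<ge> 0" "\<forall>p\<in>P. x (Some p) \<ge> 0" using x0 by (auto simp: J_def)
    have "(\<Sum>p\<in>P. m p * x (Some p)) \<le> M * x None"
    proof (cases "x None = 0")
      case True
      \<comment> \<open>without capacity every weight vanishes\<close>
      have "x (Some p) = 0" if p: "p \<in> P" for p
      proof -
        obtain e where e: "e \<in> B p" "e \<in> E" using B p by blast
        have "x (Some p) \<le> (\<Sum>p | p \<in> P \<and> e \<in> B p. x (Some p))"
          using x_nonneg e p assms(1) by (intro member_le_sum[of p]) auto
        also have "\<dots> \<le> 0" using x e True by auto
        finally show ?thesis using x_nonneg p by force
      qed
      then show ?thesis using True by simp
    next
      case False
      then have pos: "x None > 0" using x_nonneg by simp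
      have "(\<Sum>p\<in>P. m p * (x (Some p) / x None)) \<le> M"
        unfolding M_def
      proof (rule max[rule_format], intro conjI)
        show "\<forall>p\<in>P. 0 \<le> x (Some p) / x None" using x_nonneg by simp
        show "\<forall>e\<in>E. (\<Sum>p | p \<in> P \<and> e \<in> B p. x (Some p) / x None) \<le> c e"
          using x pos by (simp add: sum_divide_distrib[symmetric] pos_divide_le_eq)
      qed
      then show ?thesis using pos by (simp add: sum_divide_distrib[symmetric] pos_divide_le_eq)
    qed
    then show "(\<Sum>j\<in>J. b j * x j) \<le> 0" by (simp add: sum_J b_def)
  qed (use assms in \<open>auto simp: J_def\<close>)
  then obtain l where l: "\<forall>e\<in>E. 0 \<le> l e" "\<forall>j\<in>J. b j \<le> (\<Sum>e\<in>E. l e * A e j)" by blast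
  show ?thesis
  proof
    show "\<forall>p\<in>P. m p \<le> (\<Sum>e\<in>B p. l e)"
    proof
      fix p assume p: "p \<in> P"
      have "m p \<le> (\<Sum>e\<in>E. l e * (if e \<in> B p then 1 else 0))"
        using l(2) p by (auto simp: J_def b_def A_def)
      also have "\<dots> = (\<Sum>e\<in>E. if e \<in> B p then l e else 0)" by (intro sum.cong) auto
      also have "\<dots> = (\<Sum>e\<in>E \<inter> B p. l e)" using assms(2) by (simp add: sum.inter_restrict)
      also have "E \<inter> B p = B p" using B(1)[OF p] by blast
      finally show "m p \<le> (\<Sum>e\<in>B p. l e)" .
    qed
    have "b None \<le> (\<Sum>e\<in>E. l e * A e None)" using l(2) by (simp add: J_def)
    then show "(\<Sum>e\<in>E. c e * l e) \<le> (\<Sum>p\<in>P. m p * w p)"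
      by (simp add: A_def b_def M_def sum_negf mult.commute)
  qed (use w l in auto)
qed


section \<open>Lengths of walks\<close>

lemma sum_set_le_sum_list:
  fixes f :: "'x \<Rightarrow> real"
  assumes "\<And>x. x \<in> set xs \<Longrightarrow> 0 \<le> f x"
  shows "(\<Sum>x\<in>set xs. f x) \<le> sum_list (map f xs)"
  using assms
proof (induction xs)
  case (Cons a xs)
  then show ?case by (cases "a \<in> set xs") (auto simp: insert_absorb add_increasing)
qed simp

lemma (in wf_digraph) awalk_sum_ge_telescope:
  fixes h :: "'a \<Rightarrow> real" and g :: "'b \<Rightarrow> real"
  assumes "awalk u p v" "\<And>e. e \<in> set p \<Longrightarrow> h (head G e) - h (tail G e) \<le> g e"
  shows "h v - h u \<le> sum_list (map g p)"
  using assms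
proof (induction p arbitrary: u)
  case Nil
  then show ?case by (simp add: awalk_Nil_iff)
next
  case (Cons e p)
  then have "h v - h (head G e) \<le> sum_list (map g p)" "tail G e = u"
    by (auto simp: awalk_Cons_iff)
  then show ?case using Cons.prems(2)[of e] by simp
qed

lemma (in wf_digraph) apath_distinct_arcs: "apath u p v \<Longrightarrow> distinct p"
  by (auto simp: apath_def intro: distinct_verts_imp_distinct)

text \<open>
  The distance from \<open>s\<close> for the lengths \<open>l\<close>. It is capped by a bound \<open>M\<close> of the values of \<open>d\<close>, so
  that it is finite at the vertices that cannot be reached from \<open>s\<close> while the bounds by \<open>d\<close>
  remain true.
\<close>

lemma (in wf_digraph) capped_distance_potential:
  fixes l :: "'b \<Rightarrow> real" and d :: "'a \<Rightarrow> real"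
  assumes s: "s \<in> verts G" and T: "finite T"
    and l: "\<And>e. e \<in> arcs G \<Longrightarrow> 0 \<le> l e"
    and paths: "\<And>t p. t \<in> T \<Longrightarrow> apath s p t \<Longrightarrow> d t \<le> (\<Sum>e\<in>set p. l e)"
  obtains a where "a s \<le> 0" "\<forall>t\<in>T. d t \<le> a t"
    "\<forall>e\<in>arcs G. a (head G e) - a (tail G e) \<le> l e"
proof -
  define M where "M = Max (insert 0 (d ` T))"
  have M: "0 \<le> M" "\<And>t. t \<in> T \<Longrightarrow> d t \<le> M" using T by (auto simp: M_def)
  define L where "L v = insert M {sum_list (map l p) | p. awalk s p v}" for v
  define a where "a v = Inf (L v)" for v
  have walk_arcs: "set p \<subseteq> arcs G" if "awalk s p v" for p v
    using that by auto
  have walk_nonneg: "0 \<le> sum_list (map l p)" if "awalk s p v" for p v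
    using that l by (intro sum_list_nonneg) auto
  have bdd: "bdd_below (L v)" for v
    using walk_nonneg M by (intro bdd_belowI[of _ 0]) (auto simp: L_def)
  show ?thesis
  proof
    have "0 \<in> L s" using s by (auto simp: L_def awalk_Nil_iff intro!: exI[of _ "[]"])
    then show "a s \<le> 0" unfolding a_def by (rule cInf_lower[OF _ bdd])
  next
    show "\<forall>t\<in>T. d t \<le> a t"
    proof
      fix t assume t: "t \<in> T"
      have "d t \<le> sum_list (map l p)" if p: "awalk s p t" for p
      proof -
        have "d t \<le> (\<Sum>e\<in>set (awalk_to_apath p). l e)"
          using paths[OF t apath_awalk_to_apath[OF p]] .
        also have "\<dots> \<le> (\<Sum>e\<in>set p. l e)"
          using awalk_to_apath_subset[OF p] l walk_arcs[OF p] by (intro sum_mono2) auto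
        also have "\<dots> \<le> sum_list (map l p)"
          using walk_arcs[OF p] l by (intro sum_set_le_sum_list) auto
        finally show ?thesis .
      qed
      then show "d t \<le> a t"
        unfolding a_def using M(2)[OF t] by (intro cInf_greatest) (auto simp: L_def)
    qed
  next
    show "\<forall>e\<in>arcs G. a (head G e) - a (tail G e) \<le> l e"
    proof
      fix e assume e: "e \<in> arcs G"
      have "a (head G e) - l e \<le> x" if x: "x \<in> L (tail G e)" for x
      proof (cases "x = M")
        case True
        have "a (head G e) \<le> M" unfolding a_def by (rule cInf_lower[OF _ bdd]) (simp add: L_def)
        then show ?thesis using True l[OF e] by simp
      next
        case False
        then obtain p where p: "awalk s p (tail G e)" "x = sum_list (map l p)"
          using x False by (auto simp: L_def)
        have "awalk s (p @ [e]) (head G e)"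
          using p e by (auto simp: awalk_append_iff awalk_Cons_iff awalk_Nil_iff)
        then have "sum_list (map l (p @ [e])) \<in> L (head G e)" unfolding L_def by blast
        then have "a (head G e) \<le> sum_list (map l (p @ [e]))"
          unfolding a_def by (rule cInf_lower[OF _ bdd])
        then show ?thesis using p by simp
      qed
      then have "a (head G e) - l e \<le> a (tail G e)"
        unfolding a_def[of "tail G e"] by (intro cInf_greatest) (auto simp: L_def)
      then show "a (head G e) - a (tail G e) \<le> l e" by simp
    qed
  qed
qed


section \<open>The space \<open>Q\<^sub>\<mu>\<close>\<close>

text \<open>
  The least function on \<open>S\<^sup>c\<close> that together with \<open>b\<close> on \<open>S\<^sup>r\<close> lies in \<open>\<Pi>\<^sub>\<mu>\<close>. With the arguments
  of \<open>\<mu>\<close> exchanged, it is the least function on \<open>S\<^sup>r\<close> for a given one on \<open>S\<^sup>c\<close>.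
\<close>

definition conjugate :: "'a set \<Rightarrow> ('a \<Rightarrow> 'a \<Rightarrow> real) \<Rightarrow> ('a \<Rightarrow> real) \<Rightarrow> 'a \<Rightarrow> real" where
  "conjugate S \<mu> b s = Max ((\<lambda>t. \<mu> s t - b t) ` S)"

lemma conjugate_ge: "finite S \<Longrightarrow> t \<in> S \<Longrightarrow> \<mu> s t - b t \<le> conjugate S \<mu> b s"
  by (simp add: conjugate_def)

lemma conjugate_attained:
  assumes "finite S" "S \<noteq> {}"
  obtains t where "t \<in> S" "conjugate S \<mu> b s = \<mu> s t - b t"
proof -
  have "conjugate S \<mu> b s \<in> (\<lambda>t. \<mu> s t - b t) ` S"
    unfolding conjugate_def using assms by (intro Max_in) auto
  then show ?thesis using that by blast
qed

lemma conjugate_diff_le: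
  assumes "finite S" "S \<noteq> {}" "\<And>t. t \<in> S \<Longrightarrow> b' t - b t \<le> d"
  shows "conjugate S \<mu> b s - conjugate S \<mu> b' s \<le> d"
proof -
  obtain t where t: "t \<in> S" "conjugate S \<mu> b s = \<mu> s t - b t"
    using conjugate_attained[OF assms(1,2)] .
  show ?thesis using conjugate_ge[OF assms(1) t(1), of \<mu> s b'] assms(3)[OF t(1)] t(2) by simp
qed

definition biconjugate_point ::
    "'a set \<Rightarrow> ('a \<Rightarrow> 'a \<Rightarrow> real) \<Rightarrow> ('a \<Rightarrow> real) \<Rightarrow> 'a + 'a \<Rightarrow> real" where
  "biconjugate_point S \<mu> a =
     (let b = conjugate S (\<lambda>t s. \<mu> s t) a
      in restrict (case_sum (conjugate S \<mu> b) b) (S <+> S))"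

text \<open>
  Lowering a coordinate violates a tight constraint that contains it, unless the other coordinate of
  that constraint is raised.
\<close>

lemma Q_mu_if_tight:
  assumes p: "p \<in> Pi_mu S \<mu>"
    and tight_c: "\<And>s. s \<in> S \<Longrightarrow> \<exists>t\<in>S. p (Inl s) + p (Inr t) = \<mu> s t"
    and tight_r: "\<And>t. t \<in> S \<Longrightarrow> \<exists>s\<in>S. p (Inl s) + p (Inr t) = \<mu> s t"
  shows "p \<in> Q_mu S \<mu>"
proof -
  have "q = p" if q: "q \<in> Pi_mu S \<mu>" and le: "\<forall>x\<in>S <+> S. q x \<le> p x" for q
  proof (rule PiE_ext)
    show "q \<in> Rvec (S <+> S)" "p \<in> Rvec (S <+> S)" using p q by (auto simp: Pi_mu_def)
    have q_ge: "\<mu> s t \<le> q (Inl s) + q (Inr t)" if "s \<in> S" "t \<in> S" for s t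
      using q that by (simp add: Pi_mu_def)
    have le': "q (Inl s) \<le> p (Inl s)" "q (Inr s) \<le> p (Inr s)" if "s \<in> S" for s
      using le that by auto
    fix x assume "x \<in> S <+> S"
    then consider s where "x = Inl s" "s \<in> S" | t where "x = Inr t" "t \<in> S" by blast
    then show "q x = p x"
    proof cases
      case 1
      then obtain t where "t \<in> S" "p (Inl s) + p (Inr t) = \<mu> s t" using tight_c by blast
      then show ?thesis using q_ge[of s t] le'[of s] le'[of t] 1 by simp
    next
      case 2
      then obtain s where "s \<in> S" "p (Inl s) + p (Inr t) = \<mu> s t" using tight_r by blast
      then show ?thesis using q_ge[of s t] le'[of s] le'[of t] 2 by simp
    qed
  qed
  then show ?thesis using p unfolding Q_mu_def by blast
qed

text \<open>
  A coordinate \<open>s\<^sup>c\<close> is tight because the maximum that defines it is attained. If the maximum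
  defining \<open>t\<^sup>r\<close> is attained at \<open>s\<close>, then this constraint stays tight: the second conjugation does
  not increase \<open>a s\<close>, and it keeps the point in \<open>\<Pi>\<^sub>\<mu>\<close>.
\<close>

lemma biconjugate_point_in_Q_mu:
  assumes "finite S"
  shows "biconjugate_point S \<mu> a \<in> Q_mu S \<mu>"
proof (rule Q_mu_if_tight)
  define b where "b = conjugate S (\<lambda>t s. \<mu> s t) a"
  define a' where "a' = conjugate S \<mu> b"
  define p where "p = biconjugate_point S \<mu> a"
  have p_eq: "p = restrict (case_sum a' b) (S <+> S)"
    by (simp add: p_def biconjugate_point_def b_def a'_def Let_def)
  have pc: "p (Inl s) = a' s" and pr: "p (Inr s) = b s" if "s \<in> S" for s
    using that by (auto simp: p_eq)
  have ab: "\<mu> s t \<le> a' s + b t" if "t \<in> S" for s t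
    using conjugate_ge[OF assms that, of \<mu> s b] by (simp add: a'_def)
  show "biconjugate_point S \<mu> a \<in> Pi_mu S \<mu>"
    using ab pc pr unfolding p_def[symmetric] Pi_mu_def by (auto simp: p_eq)
  show "\<exists>t\<in>S. biconjugate_point S \<mu> a (Inl s) + biconjugate_point S \<mu> a (Inr t) = \<mu> s t"
    if s: "s \<in> S" for s
  proof -
    obtain t where "t \<in> S" "a' s = \<mu> s t - b t"
      using conjugate_attained[of S \<mu> b s] assms s unfolding a'_def by blast
    then show ?thesis using pc[OF s] pr[of t] unfolding p_def[symmetric] by (intro bexI[of _ t]) auto
  qed
  show "\<exists>s\<in>S. biconjugate_point S \<mu> a (Inl s) + biconjugate_point S \<mu> a (Inr t) = \<mu> s t"
    if t: "t \<in> S" for t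
  proof -
    obtain s where s: "s \<in> S" "b t = \<mu> s t - a s"
      using conjugate_attained[of S "\<lambda>t s. \<mu> s t" a t] assms t unfolding b_def by blast
    have "a' s \<le> a s"
    proof -
      obtain u where u: "u \<in> S" "a' s = \<mu> s u - b u"
        using conjugate_attained[of S \<mu> b s] assms t unfolding a'_def by blast
      then show ?thesis
        using conjugate_ge[OF assms s(1), of "\<lambda>t s. \<mu> s t" u a] by (simp add: b_def)
    qed
    then have "a' s + b t = \<mu> s t" using s ab[OF t, of s] by simp
    then show ?thesis using pc[OF s(1)] pr[OF t] s(1) unfolding p_def[symmetric]
      by (intro bexI[of _ s]) auto
  qed
qed

lemma D_infty_le_iff:
  assumes "finite S"
  shows "D_infty S p q \<le> d \<longleftrightarrow>
    0 \<le> d \<and> (\<forall>s\<in>S. q (Inl s) - p (Inl s) \<le> d) \<and> (\<forall>s\<in>S. p (Inr s) - q (Inr s) \<le> d)"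
  using assms by (auto simp: D_infty_def D_plus_def)

text \<open>
  If \<open>a\<close> grows by at most \<open>d\<close>, then its conjugate drops by at most \<open>d\<close>, and the conjugate of that
  grows by at most \<open>d\<close> again. These are the two directions that \<open>D\<^sub>\<infinity>\<close> measures on \<open>S\<^sup>r\<close> and on
  \<open>S\<^sup>c\<close>.
\<close>

lemma D_infty_biconjugate_point_le:
  assumes "finite S" "0 \<le> d" "\<And>s. s \<in> S \<Longrightarrow> a' s - a s \<le> d"
  shows "D_infty S (biconjugate_point S \<mu> a) (biconjugate_point S \<mu> a') \<le> d"
proof -
  let ?b = "conjugate S (\<lambda>t s. \<mu> s t)"
  have b: "?b a t - ?b a' t \<le> d" if "t \<in> S" for t
    using assms that by (intro conjugate_diff_le) auto
  then have "conjugate S \<mu> (?b a') s - conjugate S \<mu> (?b a) s \<le> d" if "s \<in> S" for s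
    using assms that by (intro conjugate_diff_le) auto
  with b show ?thesis
    using assms by (simp add: D_infty_le_iff biconjugate_point_def Let_def)
qed

text \<open>
  In both maxima the term at \<open>u\<close> already has the required value, and the triangle inequality through
  \<open>u\<close> bounds the other terms by it.
\<close>

lemma biconjugate_point_eq_mu_vec:
  assumes "finite S" "directed_metric_on S \<mu>" "u \<in> S"
    and a: "a u \<le> 0" "\<And>s. s \<in> S \<Longrightarrow> \<mu> s u \<le> a s"
  shows "biconjugate_point S \<mu> a = mu_vec S \<mu> u"
proof -
  have zero: "\<mu> u u = 0"
    and tri: "\<And>x y z. x \<in> S \<Longrightarrow> y \<in> S \<Longrightarrow> z \<in> S \<Longrightarrow> \<mu> x z \<le> \<mu> x y + \<mu> y z"
    using assms(2,3) unfolding directed_metric_on_def by blast+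
  define b where "b = conjugate S (\<lambda>t s. \<mu> s t) a"
  have b: "b t = \<mu> u t" if t: "t \<in> S" for t
  proof (rule antisym)
    obtain s where s: "s \<in> S" "b t = \<mu> s t - a s"
      using conjugate_attained[of S "\<lambda>t s. \<mu> s t" a t] assms unfolding b_def by blast
    then show "b t \<le> \<mu> u t" using a(2)[OF s(1)] tri[of s u t] t assms(3) by simp
    show "\<mu> u t \<le> b t"
      using conjugate_ge[OF assms(1,3), of "\<lambda>t s. \<mu> s t" t a] a(1) by (simp add: b_def)
  qed
  have "conjugate S \<mu> b s = \<mu> s u" if s: "s \<in> S" for s
  proof (rule antisym)
    obtain t where t: "t \<in> S" "conjugate S \<mu> b s = \<mu> s t - b t"
      using conjugate_attained[of S \<mu> b s] assms by blast
    then show "conjugate S \<mu> b s \<le> \<mu> s u" using b[OF t(1)] tri[of s u t] s assms(3) by simp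
    show "\<mu> s u \<le> conjugate S \<mu> b s"
      using conjugate_ge[OF assms(1,3), of \<mu> s b] b[OF assms(3)] zero by simp
  qed
  with b show ?thesis
    unfolding biconjugate_point_def mu_vec_def Let_def b_def[symmetric]
    by (intro restrict_ext) auto
qed

lemma bar_eq_barD:
  assumes "p \<in> Rvec (S <+> S)" "bar S p = bar S q"
  obtains k where "\<And>s. s \<in> S \<Longrightarrow> p (Inl s) = q (Inl s) + k" "\<And>s. s \<in> S \<Longrightarrow> p (Inr s) = q (Inr s) - k"
proof -
  have "p \<in> bar S p" using assms(1) by (auto simp: bar_def intro!: exI[of _ 0])
  then have "p \<in> bar S q" using assms(2) by simp
  then obtain k where k: "\<forall>x\<in>S <+> S. p x = q x + k * one_minus_one x"
    by (auto simp: bar_def)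
  show ?thesis
  proof
    fix s assume "s \<in> S"
    then have "Inl s \<in> S <+> S" "Inr s \<in> S <+> S" by auto
    then show "p (Inl s) = q (Inl s) + k" "p (Inr s) = q (Inr s) - k"
      using k by (auto simp: one_minus_one_def)
  qed
qed

text \<open>
  A section of the shifts by \<open>(1,-1)\<close>: adding \<open>k (1,-1)\<close> to the point adds \<open>k\<close> to this number, and
  it is \<open>0\<close> at every \<open>\<mu>\<^sub>s\<close>, since \<open>\<mu>\<close> is nonnegative and vanishes at \<open>(s, s)\<close>.
\<close>

definition min_c :: "'a set \<Rightarrow> ('a + 'a \<Rightarrow> real) \<Rightarrow> real" where
  "min_c S p = Min ((\<lambda>t. p (Inl t)) ` S)"

lemma min_c_diff_le_D_infty:
  assumes "finite S"
  shows "min_c S q - min_c S p \<le> D_infty S p q"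
proof (cases "S = {}")
  case True
  then show ?thesis using D_infty_le_iff[of S p q "D_infty S p q"] by (simp add: min_c_def)
next
  case False
  then have "min_c S p \<in> (\<lambda>t. p (Inl t)) ` S"
    unfolding min_c_def using assms by (intro Min_in) auto
  then obtain t where t: "t \<in> S" "min_c S p = p (Inl t)" by blast
  have "min_c S q \<le> q (Inl t)" using assms t(1) by (simp add: min_c_def)
  then show ?thesis using t D_infty_le_iff[OF assms, of p q "D_infty S p q"] by force
qed


section \<open>Flows and potentials in networks\<close>

context network
begin

lemma finite_terminals: "finite S"
  using terminals finite_verts by (rule finite_subset)

lemma finite_S_paths: "finite (S_paths G S)"
proof -
  have "S_paths G S \<subseteq> (\<Union>s\<in>S. \<Union>t\<in>S. {p. apath s p t})" by (auto simp: S_paths_def)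
  then show ?thesis
    by (rule finite_subset) (auto intro: finite_terminals apaths_finite)
qed

lemma S_pathE:
  assumes "p \<in> S_paths G S"
  obtains "path_start G p \<in> S" "path_end G p \<in> S" "apath (path_start G p) p (path_end G p)"
    "p \<noteq> []"
proof -
  obtain s t where st: "s \<in> S" "t \<in> S" "s \<noteq> t" "apath s p t"
    using assms by (auto simp: S_paths_def)
  then have "p \<noteq> []" by (auto simp: apath_Nil_iff)
  moreover from this have "s = path_start G p" "t = path_end G p"
    using st(4) by (auto simp: apath_def awalk_conv awalk_verts_conv path_start_def path_end_def
        cas_simp)
  ultimately show ?thesis using st that by auto
qed

lemma S_path_arcs: "p \<in> S_paths G S \<Longrightarrow> set p \<subseteq> arcs G"
  by (auto simp: S_paths_def apath_def awalk_def)

lemma multiflow_duality: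
  obtains w l where "multiflow G S c (S_paths G S, w)"
    "\<forall>e\<in>arcs G. 0 \<le> l e"
    "\<forall>p\<in>S_paths G S. \<mu> (path_start G p) (path_end G p) \<le> (\<Sum>e\<in>set p. l e)"
    "(\<Sum>e\<in>arcs G. real (c e) * l e) \<le> flow_val G \<mu> (S_paths G S, w)"
proof -
  have arcs: "set p \<subseteq> arcs G" "set p \<noteq> {}" if "p \<in> S_paths G S" for p
    using S_path_arcs[OF that] that by (auto elim: S_pathE)
  show ?thesis
  proof (rule packing_covering_duality[of "S_paths G S" "arcs G" set "\<lambda>e. real (c e)"
        "\<lambda>p. \<mu> (path_start G p) (path_end G p)"])
    fix w l
    assume "\<forall>p\<in>S_paths G S. 0 \<le> w p"
      "\<forall>e\<in>arcs G. (\<Sum>p | p \<in> S_paths G S \<and> e \<in> set p. w p) \<le> real (c e)"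
      "\<forall>e\<in>arcs G. 0 \<le> l e"
      "\<forall>p\<in>S_paths G S. \<mu> (path_start G p) (path_end G p) \<le> (\<Sum>e\<in>set p. l e)"
      "(\<Sum>e\<in>arcs G. real (c e) * l e) \<le>
        (\<Sum>p\<in>S_paths G S. \<mu> (path_start G p) (path_end G p) * w p)"
    then show thesis by (intro that[of w l]) (auto simp: multiflow_def flow_val_def)
  qed (use arcs finite_S_paths in auto)
qed

lemma potential_below_lengths:
  assumes metric: "directed_metric_on S \<mu>"
    and l: "\<And>e. e \<in> arcs G \<Longrightarrow> 0 \<le> l e"
    and paths: "\<And>p. p \<in> S_paths G S \<Longrightarrow> \<mu> (path_start G p) (path_end G p) \<le> (\<Sum>e\<in>set p. l e)"
  obtains \<rho> where "\<rho> \<in> potentials G S \<mu>"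
    "\<forall>e\<in>arcs G. D_infty S (\<rho> (tail G e)) (\<rho> (head G e)) \<le> l e"
proof -
  have "\<exists>a. a s \<le> 0 \<and> (\<forall>t\<in>S. \<mu> s t \<le> a t) \<and>
      (\<forall>e\<in>arcs G. a (head G e) - a (tail G e) \<le> l e)" if s: "s \<in> S" for s
  proof -
    have dist: "\<mu> s t \<le> (\<Sum>e\<in>set p. l e)" if t: "t \<in> S" and p: "apath s p t" for t p
    proof (cases "s = t")
      case True
      have "0 \<le> (\<Sum>e\<in>set p. l e)" using p l by (intro sum_nonneg) (auto simp: apath_def)
      then show ?thesis using metric True s by (simp add: directed_metric_on_def)
    next
      case False
      then have "p \<in> S_paths G S" using s t p by (auto simp: S_paths_def)
      moreover from this have "path_start G p = s" "path_end G p = t"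
        using p by (auto elim!: S_pathE dest: apath_ends)
      ultimately show ?thesis using paths[of p] by simp
    qed
    have "s \<in> verts G" using s terminals by blast
    then obtain a where "a s \<le> 0" "\<forall>t\<in>S. \<mu> s t \<le> a t"
        "\<forall>e\<in>arcs G. a (head G e) - a (tail G e) \<le> l e"
      by (rule capped_distance_potential[OF _ finite_terminals l dist])
    then show ?thesis by blast
  qed
  then obtain a where a: "\<And>s. s \<in> S \<Longrightarrow> a s s \<le> 0"
    "\<And>s t. s \<in> S \<Longrightarrow> t \<in> S \<Longrightarrow> \<mu> s t \<le> a s t"
    "\<And>s e. s \<in> S \<Longrightarrow> e \<in> arcs G \<Longrightarrow> a s (head G e) - a s (tail G e) \<le> l e"
    by metis
  define \<rho> where "\<rho> x = biconjugate_point S \<mu> (\<lambda>s. a s x)" for x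
  show ?thesis
  proof
    have "\<rho> s = mu_vec S \<mu> s" if "s \<in> S" for s
      unfolding \<rho>_def using finite_terminals metric that a
      by (intro biconjugate_point_eq_mu_vec) auto
    then show "\<rho> \<in> potentials G S \<mu>"
      using biconjugate_point_in_Q_mu[OF finite_terminals] by (auto simp: potentials_def \<rho>_def)
    show "\<forall>e\<in>arcs G. D_infty S (\<rho> (tail G e)) (\<rho> (head G e)) \<le> l e"
      unfolding \<rho>_def using finite_terminals l a
      by (intro ballI D_infty_biconjugate_point_le) auto
  qed
qed

lemma sum_arcs_paths_le:
  assumes f: "multiflow G S c (P, w)" and g: "\<And>e. e \<in> arcs G \<Longrightarrow> 0 \<le> g e"
  shows "(\<Sum>p\<in>P. (\<Sum>e\<in>set p. g e) * w p) \<le> (\<Sum>e\<in>arcs G. real (c e) * g e)"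
proof -
  have P: "P \<subseteq> S_paths G S" and cap: "\<And>e. e \<in> arcs G \<Longrightarrow> (\<Sum>p | p \<in> P \<and> e \<in> set p. w p) \<le> real (c e)"
    using f by (auto simp: multiflow_def)
  have finP: "finite P" using P finite_S_paths by (rule finite_subset)
  have "(\<Sum>p\<in>P. (\<Sum>e\<in>set p. g e) * w p) = (\<Sum>p\<in>P. \<Sum>e\<in>arcs G. if e \<in> set p then g e * w p else 0)"
  proof (rule sum.cong)
    fix p assume "p \<in> P"
    then have "set p \<subseteq> arcs G" using P S_path_arcs by blast
    then have "arcs G \<inter> set p = set p" by blast
    then show "(\<Sum>e\<in>set p. g e) * w p = (\<Sum>e\<in>arcs G. if e \<in> set p then g e * w p else 0)"
      by (simp add: sum_distrib_right sum.inter_restrict[symmetric])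
  qed simp
  also have "\<dots> = (\<Sum>e\<in>arcs G. \<Sum>p\<in>P. if e \<in> set p then g e * w p else 0)"
    by (rule sum.swap)
  also have "\<dots> = (\<Sum>e\<in>arcs G. (\<Sum>p | p \<in> P \<and> e \<in> set p. w p) * g e)"
    using finP by (simp add: sum.inter_filter[symmetric] sum_distrib_left mult.commute)
  also have "\<dots> \<le> (\<Sum>e\<in>arcs G. real (c e) * g e)"
    using cap g by (intro sum_mono mult_right_mono) auto
  finally show ?thesis .
qed

end

lemma (in eulerian_network) sum_potential_differences_eq_0:
  fixes h :: "'a \<Rightarrow> real"
  shows "(\<Sum>e\<in>arcs G. real (c e) * (h (head G e) - h (tail G e))) = 0"
proof -
  have "(\<Sum>e\<in>arcs G. real (c e) * h (head G e)) =
      (\<Sum>x\<in>verts G. \<Sum>e | e \<in> arcs G \<and> head G e = x. real (c e) * h (head G e))"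
    by (rule sum.group[symmetric]) auto
  also have "\<dots> = (\<Sum>x\<in>verts G. h x * real (\<Sum>e\<in>in_arcs G x. c e))"
    by (intro sum.cong) (auto simp: in_arcs_def sum_distrib_left mult.commute intro!: sum.cong)
  also have "\<dots> = (\<Sum>x\<in>verts G. h x * real (\<Sum>e\<in>out_arcs G x. c e))"
    by (intro sum.cong) (auto simp: eulerian)
  also have "\<dots> = (\<Sum>x\<in>verts G. \<Sum>e | e \<in> arcs G \<and> tail G e = x. real (c e) * h (tail G e))"
    by (intro sum.cong) (auto simp: out_arcs_def sum_distrib_left mult.commute intro!: sum.cong)
  also have "\<dots> = (\<Sum>e\<in>arcs G. real (c e) * h (tail G e))"
    by (rule sum.group) auto
  finally show ?thesis by (simp add: right_diff_distrib sum_subtractf)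
qed

text \<open>
  Let \<open>h\<close> be the value of \<open>min_c\<close> on the potential. The reduced lengths \<open>g\<close> are nonnegative and
  have the same total cost as \<open>D\<^sub>\<infinity>\<close> because the network is Eulerian. For a path that
  starts at \<open>s\<close>, they dominate the increases of \<open>h' x = \<rho> x (Inl s) - h x\<close>. This function does not see
  shifts by \<open>(1,-1)\<close>; so at every terminal \<open>t\<close> it has the value that \<open>\<mu>\<^sub>t\<close> gives, which is \<open>\<mu> s t\<close>.
\<close>

lemma (in eulerian_network) flow_val_le_potential_cost:
  assumes metric: "directed_metric_on S \<mu>"
    and f: "multiflow G S c (P, w)" and \<rho>: "\<rho> \<in> potentials G S \<mu>"
  shows "flow_val G \<mu> (P, w) \<le> potential_cost G S c \<rho>"
proof -
  define h where "h x = min_c S (\<rho> x)" for x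
  define D where "D e = D_infty S (\<rho> (tail G e)) (\<rho> (head G e))" for e
  define g where "g e = D e - (h (head G e) - h (tail G e))" for e
  have P: "P \<subseteq> S_paths G S" and w: "\<And>p. p \<in> P \<Longrightarrow> 0 \<le> w p"
    using f by (auto simp: multiflow_def)
  have g_nonneg: "0 \<le> g e" for e
    using min_c_diff_le_D_infty[OF finite_terminals] by (simp add: g_def h_def D_def)
  have terminal: "\<rho> t (Inl s) - h t = \<mu> s t" if s: "s \<in> S" and t: "t \<in> S" for s t
  proof -
    have "\<rho> t \<in> Rvec (S <+> S)" "bar S (\<rho> t) = bar S (mu_vec S \<mu> t)"
      using \<rho> t terminals unfolding potentials_def Q_mu_def Pi_mu_def by blast+
    then obtain k where k: "\<And>s. s \<in> S \<Longrightarrow> \<rho> t (Inl s) = mu_vec S \<mu> t (Inl s) + k"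
      by (rule bar_eq_barD) blast
    then have k: "\<rho> t (Inl s) = \<mu> s t + k" if "s \<in> S" for s
      using that by (simp add: mu_vec_def InlI)
    \<comment> \<open>the shift at \<open>t\<close> is the minimum, attained at the coordinate of \<open>t\<close> itself\<close>
    have "h t = k" unfolding h_def min_c_def
    proof (rule Min_eqI)
      show "finite ((\<lambda>s. \<rho> t (Inl s)) ` S)" using finite_terminals by simp
      show "k \<le> y" if "y \<in> (\<lambda>s. \<rho> t (Inl s)) ` S" for y
        using that k metric t by (auto simp: directed_metric_on_def)
      have "\<rho> t (Inl t) = k" using k[OF t] metric t by (simp add: directed_metric_on_def)
      then show "k \<in> (\<lambda>s. \<rho> t (Inl s)) ` S" using t by blast
    qed
    then show ?thesis using k s by simp
  qed
  have path: "\<mu> (path_start G p) (path_end G p) \<le> (\<Sum>e\<in>set p. g e)" if "p \<in> P" for p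
  proof -
    define s t where "s = path_start G p" and "t = path_end G p"
    have st: "s \<in> S" "t \<in> S" "apath s p t"
      using that P by (auto elim!: S_pathE simp: s_def t_def)
    define h' where "h' x = \<rho> x (Inl s) - h x" for x
    have "h' (head G e) - h' (tail G e) \<le> g e" for e
      using D_infty_le_iff[OF finite_terminals, of "\<rho> (tail G e)" "\<rho> (head G e)" "D e"] st(1)
      by (force simp: h'_def g_def D_def)
    then have "h' t - h' s \<le> sum_list (map g p)"
      using st(3) by (intro awalk_sum_ge_telescope) (auto simp: apath_def)
    also have "\<dots> = (\<Sum>e\<in>set p. g e)"
      using apath_distinct_arcs[OF st(3)] by (rule sum_list_distinct_conv_sum_set)
    finally have "h' t - h' s \<le> (\<Sum>e\<in>set p. g e)" .
    moreover have "h' t = \<mu> s t" "h' s = 0"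
      using terminal st metric by (auto simp: h'_def directed_metric_on_def)
    ultimately show ?thesis by (simp add: s_def t_def)
  qed
  have "flow_val G \<mu> (P, w) \<le> (\<Sum>p\<in>P. (\<Sum>e\<in>set p. g e) * w p)"
    using path w by (auto simp: flow_val_def intro!: sum_mono mult_right_mono)
  also have "\<dots> \<le> (\<Sum>e\<in>arcs G. real (c e) * g e)"
    using f g_nonneg by (rule sum_arcs_paths_le)
  also have "\<dots> = (\<Sum>e\<in>arcs G. real (c e) * D e)"
    using sum_potential_differences_eq_0[of h]
    by (simp add: g_def right_diff_distrib sum_subtractf)
  also have "\<dots> = potential_cost G S c \<rho>" by (simp add: potential_cost_def D_def)
  finally show ?thesis .
qed

theorem theorem4p2:
  fixes G :: "('a, 'b) pre_digraph" and S :: "'a set" and c :: "'b \<Rightarrow> nat"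
    and \<mu> :: "'a \<Rightarrow> 'a \<Rightarrow> real"
  assumes "eulerian_network G S c" and "directed_metric_on S \<mu>"
  shows "\<exists>m. is_max {flow_val G \<mu> f | f. multiflow G S c f} m \<and>
             is_min {potential_cost G S c \<rho> | \<rho>. \<rho> \<in> potentials G S \<mu>} m"
proof -
  interpret eulerian_network G S c by fact
  obtain w l where w: "multiflow G S c (S_paths G S, w)"
    and l: "\<forall>e\<in>arcs G. 0 \<le> l e"
      "\<forall>p\<in>S_paths G S. \<mu> (path_start G p) (path_end G p) \<le> (\<Sum>e\<in>set p. l e)"
    and le: "(\<Sum>e\<in>arcs G. real (c e) * l e) \<le> flow_val G \<mu> (S_paths G S, w)"
    by (rule multiflow_duality[where \<mu> = \<mu>])
  obtain \<rho> where \<rho>: "\<rho> \<in> potentials G S \<mu>"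
    "\<forall>e\<in>arcs G. D_infty S (\<rho> (tail G e)) (\<rho> (head G e)) \<le> l e"
    by (rule potential_below_lengths[OF assms(2) l[rule_format]])
  have weak: "flow_val G \<mu> f \<le> potential_cost G S c \<sigma>"
    if "multiflow G S c f" "\<sigma> \<in> potentials G S \<mu>" for f \<sigma>
    using flow_val_le_potential_cost[OF assms(2)] that by (cases f) auto
  have "potential_cost G S c \<rho> \<le> (\<Sum>e\<in>arcs G. real (c e) * l e)"
    unfolding potential_cost_def using \<rho>(2) by (intro sum_mono mult_left_mono) auto
  with le have "potential_cost G S c \<rho> \<le> flow_val G \<mu> (S_paths G S, w)" by simp
  with weak[OF w \<rho>(1)] have eq: "potential_cost G S c \<rho> = flow_val G \<mu> (S_paths G S, w)"
    by simp
  have "is_max {flow_val G \<mu> f | f. multiflow G S c f} (potential_cost G S c \<rho>)"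
    unfolding is_max_def using weak[OF _ \<rho>(1)] w eq by auto
  moreover have "is_min {potential_cost G S c \<rho> | \<rho>. \<rho> \<in> potentials G S \<mu>} (potential_cost G S c \<rho>)"
  proof -
    have "potential_cost G S c \<rho> \<le> potential_cost G S c \<sigma>" if "\<sigma> \<in> potentials G S \<mu>" for \<sigma>
      using weak[OF w that] eq by simp
    then show ?thesis unfolding is_min_def using \<rho>(1) by blast
  qed
  ultimately show ?thesis by blast
qed

end
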